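(* Let $a, b$ be integers with $b > a \ge 2$. Let $c = \lfloor 1 + b/(a+1) \rfloor$, let $\beta \in \{0, \dotsc, a\}$ be the remainder of $b$ modulo $a+1$, and let $\alpha = a + 1 - \beta$. If $\beta \in \{0, 1, a\}$, or if the inequality $$\frac{\alpha - 1}{2\alpha} \left( 1 - \sqrt{\frac{c-1}{c}} \right)^2 + \frac{\beta - 1}{2\beta} \left( 1 - \sqrt{\frac{c}{c+1}} \right)^2 \le \left( 1 - \sqrt{\frac{1}{2} \left( \frac{c-1}{c} + \frac{c}{c+1} \right)} \right)^2$$ holds, then $e(E^a \oplus_1 E^b) \ge a + b + 1$.
   Context: An equilateral set in a normed space $(X, \lVert\cdot\rVert)$ is a subset $S \subset X$ for which there is a fixed $\lambda > 0$ such that $\lVert x - y\rVert = \lambda$ for all distinct $x, y \in S$. For a finite-dimensional real normed space $X$, $e(X)$ denotes the maximum size of an equilateral set in $X$. $E^n$ denotes real $n$-dimensional Euclidean space, i.e. $\mathbb{R}^n$ with the Euclidean norm $\lVert\cdot\rVert_2$. $E^a \oplus_1 E^b$ denotes $\mathbb{R}^a \times \mathbb{R}^b$ equipped with the norm $\lVert (x,y)\rVert = \lVert x\rVert_2 + \lVert y\rVert_2$ for $x \in \mathbb{R}^a$, $y \in \mathbb{R}^b$. *)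

theory Defs
  imports "HOL-Analysis.Analysis"
begin

text \<open>The product type \<open>'a \<times> 'b\<close> of the library already carries the norm
  \<open>sqrt ((norm x)\<^sup>2 + (norm y)\<^sup>2)\<close>, so the \<open>\<ell>\<^sub>1\<close>-sum needs a type of its own.\<close>

datatype ('a, 'b) l1_sum (infixr "\<oplus>\<^sub>1" 21) = L1_Pair (l1_fst: 'a) (l1_snd: 'b)

instantiation l1_sum :: (real_normed_vector, real_normed_vector) real_normed_vector
begin

definition "0 = L1_Pair 0 0"
definition "u + v = L1_Pair (l1_fst u + l1_fst v) (l1_snd u + l1_snd v)"
definition "u - v = L1_Pair (l1_fst u - l1_fst v) (l1_snd u - l1_snd v)"
definition "- u = L1_Pair (- l1_fst u) (- l1_snd u)"
definition "r *\<^sub>R u = L1_Pair (r *\<^sub>R l1_fst u) (r *\<^sub>R l1_snd u)"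
definition "norm u = norm (l1_fst u) + norm (l1_snd u)"
definition "dist (u :: ('a, 'b) l1_sum) v = norm (u - v)"
definition "sgn (u :: ('a, 'b) l1_sum) = inverse (norm u) *\<^sub>R u"
definition "(uniformity :: (('a, 'b) l1_sum \<times> ('a, 'b) l1_sum) filter)
  = (INF e\<in>{0<..}. principal {(u, v). dist u v < e})"
definition "open (U :: ('a, 'b) l1_sum set) \<longleftrightarrow>
  (\<forall>u\<in>U. \<forall>\<^sub>F (u', v) in uniformity. u' = u \<longrightarrow> v \<in> U)"

instance
proof
  fix r :: real and u v :: "('a, 'b) l1_sum"
  show "norm (u + v) \<le> norm u + norm v"
    using norm_triangle_ineq[of "l1_fst u" "l1_fst v"] norm_triangle_ineq[of "l1_snd u" "l1_snd v"]
    by (simp add: norm_l1_sum_def plus_l1_sum_def)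
  show "norm u = 0 \<longleftrightarrow> u = 0"
    by (cases u) (simp add: norm_l1_sum_def zero_l1_sum_def add_nonneg_eq_0_iff)
  show "norm (r *\<^sub>R u) = \<bar>r\<bar> * norm u"
    by (simp add: norm_l1_sum_def scaleR_l1_sum_def distrib_left)
qed (simp_all only: dist_l1_sum_def sgn_l1_sum_def uniformity_l1_sum_def open_l1_sum_def,
    simp_all add: zero_l1_sum_def plus_l1_sum_def minus_l1_sum_def uminus_l1_sum_def
      scaleR_l1_sum_def scaleR_add_left scaleR_add_right)

end

definition equilateral :: "'a::real_normed_vector set \<Rightarrow> bool" where
  "equilateral S \<longleftrightarrow> (\<exists>l>0. \<forall>x\<in>S. \<forall>y\<in>S. x \<noteq> y \<longrightarrow> norm (x - y) = l)"

text \<open>The maximum exists for the spaces considered here, see \<open>equilateral_size_attained\<close> and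
  \<open>equilateral_size_upper\<close>.\<close>

definition equilateral_size :: "'a::real_normed_vector itself \<Rightarrow> nat" where
  "equilateral_size _ = (GREATEST n. \<exists>S::'a set. equilateral S \<and> finite S \<and> card S = n)"

lemma equilateral_bounded:
  "\<exists>N. \<forall>S :: ('a::euclidean_space \<oplus>\<^sub>1 'b::euclidean_space) set.
    equilateral S \<longrightarrow> finite S \<and> card S \<le> N"
proof -
  let ?p = "\<lambda>u :: 'a \<oplus>\<^sub>1 'b. (l1_fst u, l1_snd u)"
  have "compact (cball 0 1 \<times> cball 0 1 :: ('a \<times> 'b) set)"
    by (intro compact_Times compact_cball)
  then obtain K :: "('a \<times> 'b) set" where K: "finite K"
      "cball 0 1 \<times> cball 0 1 \<subseteq> (\<Union>k\<in>K. ball k (1/4))"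
    unfolding compact_eq_totally_bounded
    by (elim conjE allE[of _ "1/4"]) auto
  have "finite S \<and> card S \<le> card K" if S: "equilateral S" for S :: "('a \<oplus>\<^sub>1 'b) set"
  proof (cases "S = {}")
    case False
    then obtain s where s: "s \<in> S" by blast
    from S obtain l where l: "l > 0" "\<And>x y. x \<in> S \<Longrightarrow> y \<in> S \<Longrightarrow> x \<noteq> y \<Longrightarrow> norm (x - y) = l"
      unfolding equilateral_def by blast
    let ?f = "\<lambda>x. ?p ((1/l) *\<^sub>R (x - s))"
    have "\<exists>k\<in>K. dist k (?f x) < 1/4" if "x \<in> S" for x
    proof -
      have "norm (x - s) \<le> l" using l s that by (cases "x = s") auto
      hence "norm ((1/l) *\<^sub>R (x - s)) \<le> 1" using l(1) by (simp add: divide_simps)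
      hence "norm (fst (?f x)) + norm (snd (?f x)) \<le> 1"
        by (simp only: norm_l1_sum_def fst_conv snd_conv)
      hence "norm (fst (?f x)) \<le> 1" "norm (snd (?f x)) \<le> 1"
        using norm_ge_zero[of "fst (?f x)"] norm_ge_zero[of "snd (?f x)"] by linarith+
      hence "?f x \<in> cball 0 1 \<times> cball 0 1" by simp
      hence "?f x \<in> (\<Union>k\<in>K. ball k (1/4))" using K(2) by blast
      thus ?thesis by (simp add: mem_ball)
    qed
    then obtain g where g: "\<And>x. x \<in> S \<Longrightarrow> g x \<in> K \<and> dist (g x) (?f x) < 1/4" by metis
    have inj: "inj_on g S"
    proof (rule inj_onI, rule ccontr)
      fix x y assume xy: "x \<in> S" "y \<in> S" "g x = g y" "x \<noteq> y"
      have d: "dist (?f x) (?f y) < 1/2"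
        using g[OF xy(1)] g[OF xy(2)] xy(3) dist_triangle_half_r[of "g x" "?f x" "1/2" "?f y"] by simp
      have "dist (fst (?f x)) (fst (?f y)) < 1/2" "dist (snd (?f x)) (snd (?f y)) < 1/2"
        using d dist_fst_le[of "?f x" "?f y"] dist_snd_le[of "?f x" "?f y"] by linarith+
      moreover have "?f x - ?f y = ?p ((1/l) *\<^sub>R (x - y))"
        by (simp add: minus_l1_sum_def scaleR_l1_sum_def algebra_simps)
      hence "fst (?f x) - fst (?f y) = l1_fst ((1/l) *\<^sub>R (x - y))"
        "snd (?f x) - snd (?f y) = l1_snd ((1/l) *\<^sub>R (x - y))"
        by (metis fst_diff fst_conv, metis snd_diff snd_conv)
      ultimately have "norm ((1/l) *\<^sub>R (x - y)) < 1"
        unfolding norm_l1_sum_def dist_norm by simp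
      thus False using l(1) l(2)[OF xy(1,2,4)] by simp
    qed
    have "g ` S \<subseteq> K" using g by blast
    thus ?thesis using inj K(1) by (meson card_inj_on_le inj_on_finite)
  qed simp
  thus ?thesis by blast
qed

lemma
  fixes T :: "('a::euclidean_space \<oplus>\<^sub>1 'b::euclidean_space) itself"
  shows equilateral_size_attained:
      "\<exists>S :: ('a \<oplus>\<^sub>1 'b) set. equilateral S \<and> finite S \<and> card S = equilateral_size T"
    and equilateral_size_upper:
      "\<And>S :: ('a \<oplus>\<^sub>1 'b) set. equilateral S \<Longrightarrow> finite S \<and> card S \<le> equilateral_size T"
proof -
  let ?P = "\<lambda>n. \<exists>S :: ('a \<oplus>\<^sub>1 'b) set. equilateral S \<and> finite S \<and> card S = n"
  obtain N where N: "\<And>S :: ('a \<oplus>\<^sub>1 'b) set. equilateral S \<Longrightarrow> finite S \<and> card S \<le> N"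
    using equilateral_bounded by blast
  hence bd: "\<And>n. ?P n \<Longrightarrow> n \<le> N" by blast
  have "equilateral ({} :: ('a \<oplus>\<^sub>1 'b) set)" by (auto simp: equilateral_def intro: exI[of _ 1])
  hence "?P 0" by force
  thus "?P (equilateral_size T)"
    unfolding equilateral_size_def by (rule GreatestI_nat) (rule bd)
  fix S :: "('a \<oplus>\<^sub>1 'b) set" assume S: "equilateral S"
  show "finite S \<and> card S \<le> equilateral_size T"
    unfolding equilateral_size_def using N[OF S] S by (auto intro!: Greatest_le_nat bd)
qed

end

theory Submission imports Defs begin

text \<open>
  Since \<open>b = (c - 1) (a + 1) + \<beta>\<close>, the number \<open>a + b + 1\<close> equals \<open>\<alpha> c + \<beta> (c + 1)\<close>: the points can be
  split into \<open>a + 1\<close> groups, \<open>\<alpha>\<close> of them with \<open>c\<close> points and \<open>\<beta>\<close> with \<open>c + 1\<close> points. All points of a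
  group receive the same component in \<open>E\<^sup>a\<close>, and their components in \<open>E\<^sup>b\<close> form a regular simplex of
  edge length 1 centred at the origin. The dimensions of these simplices add up to
  \<open>(a + b + 1) - (a + 1) = b\<close>, so they can be placed in mutually orthogonal subspaces
  (\<open>orthogonal_regular_simplices\<close>). A simplex with \<open>n\<close> vertices has squared circumradius
  \<open>(n - 1) / (2 n)\<close>; hence vertices of different simplices, with \<open>n\<close> and \<open>n'\<close> vertices, are at distance
  \<open>sqrt (((n - 1) / n + (n' - 1) / n') / 2)\<close>, which is less than 1 and depends on \<open>n\<close> and \<open>n'\<close> only.

  It remains to find \<open>a + 1\<close> points in \<open>E\<^sup>a\<close>, one for each group, whose distances make up for what is
  missing to 1. With \<open>d\<^sub>1\<close>, \<open>d\<^sub>2\<close>, \<open>d\<close> the missing lengths between two small groups, two large groups, and a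
  small and a large one, this asks for a regular simplex with \<open>\<alpha>\<close> vertices and edge \<open>d\<^sub>1\<close> and one with \<open>\<beta>\<close>
  vertices and edge \<open>d\<^sub>2\<close>, such that all distances between the two are \<open>d\<close>. Put them in orthogonal
  directions, which takes \<open>(\<alpha> - 1) + (\<beta> - 1) = a - 1\<close> dimensions, and use the last dimension to move
  their centres to a distance \<open>h\<close>. By Pythagoras, \<open>d\<^sup>2\<close> must be \<open>h\<^sup>2\<close> plus the two squared circumradii, and
  such an \<open>h\<close> exists precisely under the inequality of the theorem
  (\<open>two_regular_simplices_at_distance\<close>). For \<open>\<beta> = 0\<close> a single simplex suffices. For \<open>\<beta> = 1\<close> and
  \<open>\<beta> = a\<close>, one of the two simplices is a point and the inequality always holds: in the second case because
  \<open>d\<^sub>2 \<le> d\<close>, in the first by the estimate \<open>one_minus_sqrt_average_ge\<close>.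
\<close>

section \<open>Regular simplices in orthogonal subspaces\<close>

text \<open>
  The inner products in the conclusion are those of the vertices of regular simplices with edge
  length 1 and centre 0, the \<open>i\<close>-th one having dimension \<open>k i\<close> and \<open>k i + 1\<close> vertices. Distribute the
  standard basis over the simplices. In its share \<open>e\<^sub>0, \<dots>, e\<^sub>k\<^sub>-\<^sub>1\<close> with sum \<open>\<sigma>\<close>, the vectors \<open>e\<^sub>j / sqrt 2\<close> are
  already at mutual distance 1; adding one common multiple of \<open>\<sigma>\<close> to all of them keeps the distances, and
  the remaining vertex lies on the line of \<open>\<sigma>\<close> by symmetry.
\<close>

lemma orthogonal_regular_simplices:
  fixes k :: "'i \<Rightarrow> nat"
  assumes "finite I" and "(\<Sum>i\<in>I. k i) \<le> DIM('a::euclidean_space)"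
  shows "\<exists>f :: 'i \<Rightarrow> nat \<Rightarrow> 'a. \<forall>i\<in>I. \<forall>i'\<in>I. \<forall>j\<le>k i. \<forall>j'\<le>k i'.
    f i j \<bullet> f i' j' =
      (if i = i' then (if j = j' then 1 / 2 else 0) - 1 / (2 * (real (k i) + 1)) else 0)"
proof -
  have "card (SIGMA i:I. {..<k i}) \<le> card (Basis :: 'a set)"
    using assms by simp
  then obtain g :: "'i \<times> nat \<Rightarrow> 'a" where
    g: "g ` (SIGMA i:I. {..<k i}) \<subseteq> Basis" "inj_on g (SIGMA i:I. {..<k i})"
    using card_le_inj[of "SIGMA i:I. {..<k i}" "Basis :: 'a set"] assms(1) by auto
  define e where "e i j = g (i, j)" for i j
  have ee: "e i j \<bullet> e i' j' = (if i = i' \<and> j = j' then 1 else 0)"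
    if "i \<in> I" "i' \<in> I" "j < k i" "j' < k i'" for i i' j j'
  proof -
    have m: "(i, j) \<in> (SIGMA i:I. {..<k i})" "(i', j') \<in> (SIGMA i:I. {..<k i})"
      using that by auto
    hence "e i j \<in> Basis" "e i' j' \<in> Basis" using g(1) unfolding e_def by blast+
    moreover have "e i j = e i' j' \<longleftrightarrow> i = i' \<and> j = j'"
      unfolding e_def using inj_on_eq_iff[OF g(2) m] by simp
    ultimately show ?thesis by (simp add: inner_Basis)
  qed
  define \<sigma> where "\<sigma> i = (\<Sum>j<k i. e i j)" for i
  have se: "\<sigma> i \<bullet> e i' j' = (if i = i' then 1 else 0)"
    if "i \<in> I" "i' \<in> I" "j' < k i'" for i i' j'
    using that by (auto simp: \<sigma>_def inner_sum_left ee sum.delta' cong: if_cong)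
  have es: "e i' j' \<bullet> \<sigma> i = (if i = i' then 1 else 0)"
    if "i \<in> I" "i' \<in> I" "j' < k i'" for i i' j'
    using se[OF that] by (simp add: inner_commute)
  have ss: "\<sigma> i \<bullet> \<sigma> i' = (if i = i' then real (k i) else 0)" if "i \<in> I" "i' \<in> I" for i i'
    using that by (simp add: \<sigma>_def[of i'] inner_sum_right se)
  define s where "s i = 1 / sqrt (2 * (real (k i) + 1))" for i
  define p :: real where "p = 1 / sqrt 2"
  define q where "q i = (s i - p) / real (k i)" for i
  have p2: "p * p = 1 / 2" by (simp add: p_def)
  have s2: "s i * s i = 1 / (2 * (real (k i) + 1))" for i by (simp add: s_def)
  have s2k: "s i * s i * real (k i) = 1 / 2 - s i * s i" for i
    unfolding s2 by (simp add: field_simps)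
  have qk: "q i * real (k i) = s i - p" if "k i > 0" for i
    using that by (simp add: q_def)
  \<comment> \<open>The left-hand side is the inner product of two different vertices of the form \<open>p e + q \<sigma>\<close>; the
    right-hand side is that of one of them with the last vertex \<open>- s \<sigma>\<close>.\<close>
  have pq: "2 * p * q i + q i * q i * real (k i) = - (s i * s i)" if "k i > 0" for i
  proof -
    have "real (k i) * (2 * p * q i + q i * q i * real (k i))
        = 2 * p * (q i * real (k i)) + (q i * real (k i)) * (q i * real (k i))"
      by (simp add: algebra_simps)
    also have "\<dots> = s i * s i - p * p" unfolding qk[OF that] by (simp add: algebra_simps)
    also have "\<dots> = real (k i) * (- (s i * s i))" using s2k[of i] p2 by (simp add: algebra_simps)
    finally show ?thesis using that by (subst (asm) mult_left_cancel) auto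
  qed
  define f where "f i j = (if j < k i then p *\<^sub>R e i j + q i *\<^sub>R \<sigma> i else - s i *\<^sub>R \<sigma> i)" for i j
  have "f i j \<bullet> f i' j' =
      (if i = i' then (if j = j' then 1 / 2 else 0) - 1 / (2 * (real (k i) + 1)) else 0)"
    if ij: "i \<in> I" "i' \<in> I" "j \<le> k i" "j' \<le> k i'" for i i' j j'
  proof (cases "i = i'")
    case False
    then show ?thesis using ij
      by (auto simp: f_def inner_add_left inner_add_right ee se es ss)
  next
    case True
    have "f i j \<bullet> f i j' = (if j = j' then 1 / 2 else 0) - s i * s i"
    proof (cases "j < k i"; cases "j' < k i")
      assume j: "j < k i" "j' < k i"
      have "f i j \<bullet> f i j' = (if j = j' then p * p else 0) + (2 * p * q i + q i * q i * real (k i))"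
        using j ij by (simp add: f_def inner_add_left inner_add_right ee se es ss algebra_simps)
      thus ?thesis using pq[of i] j p2 by auto
    next
      assume j: "j < k i" "\<not> j' < k i"
      have "f i j \<bullet> f i j' = - s i * (p + q i * real (k i))"
        using j ij by (simp add: f_def inner_add_left inner_add_right ee se es ss algebra_simps)
      thus ?thesis using qk[of i] j by auto
    next
      assume j: "\<not> j < k i" "j' < k i"
      have "f i j \<bullet> f i j' = - s i * (p + q i * real (k i))"
        using j ij by (simp add: f_def inner_add_left inner_add_right ee se es ss algebra_simps)
      thus ?thesis using qk[of i] j by auto
    next
      assume j: "\<not> j < k i" "\<not> j' < k i"
      hence "j = j'" using ij True by simp
      have "f i j \<bullet> f i j' = s i * s i * real (k i)"
        using j ij by (simp add: f_def ss)
      thus ?thesis using s2k[of i] \<open>j = j'\<close> by simp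
    qed
    thus ?thesis using True by (simp add: s2)
  qed
  thus ?thesis by blast
qed

lemma norm_diff_eq_sqrt_inner:
  fixes u v :: "'a::real_inner"
  shows "norm (u - v) = sqrt (u \<bullet> u + v \<bullet> v - 2 * (u \<bullet> v))"
  by (simp add: norm_eq_sqrt_inner inner_diff_left inner_diff_right inner_commute)

section \<open>Two regular simplices at a constant distance\<close>

text \<open>
  The hypothesis bounds the sum of the squared circumradii of the two simplices by \<open>d\<^sup>2\<close>, which leaves a
  nonnegative square for the distance of their centres.
\<close>

lemma two_regular_simplices_at_distance:
  fixes \<alpha> \<beta> :: nat and d\<^sub>1 d\<^sub>2 d :: real
  assumes "\<alpha> \<ge> 1" and "\<alpha> + \<beta> \<le> DIM('a::euclidean_space) + 1"
    and d: "d\<^sub>1 \<ge> 0" "d\<^sub>2 \<ge> 0" "d \<ge> 0"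
    and ineq: "\<beta> \<ge> 1 \<Longrightarrow>
      (real \<alpha> - 1) / (2 * real \<alpha>) * d\<^sub>1\<^sup>2 + (real \<beta> - 1) / (2 * real \<beta>) * d\<^sub>2\<^sup>2 \<le> d\<^sup>2"
  shows "\<exists>x :: nat \<Rightarrow> 'a. \<forall>i<\<alpha> + \<beta>. \<forall>j<\<alpha> + \<beta>. i \<noteq> j \<longrightarrow>
    norm (x i - x j) = (if i < \<alpha> \<and> j < \<alpha> then d\<^sub>1 else if i < \<alpha> \<or> j < \<alpha> then d else d\<^sub>2)"
proof -
  \<comment> \<open>The third simplex is a segment and supplies the direction orthogonal to the other two. For
    \<open>\<beta> = 0\<close> the first simplex may fill the whole space, so the segment shrinks to a point.\<close>
  define k :: "nat \<Rightarrow> nat" where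
    "k = (\<lambda>t. if t = 0 then \<alpha> - 1 else if t = 1 then \<beta> - 1 else if \<beta> = 0 then 0 else 1)"
  have "(\<Sum>t\<in>{0, 1, 2}. k t) \<le> DIM('a)"
    using assms(1,2) by (auto simp: k_def)
  then obtain f :: "nat \<Rightarrow> nat \<Rightarrow> 'a" where f: "\<And>t t' j j'. t \<in> {0, 1, 2} \<Longrightarrow> t' \<in> {0, 1, 2} \<Longrightarrow>
      j \<le> k t \<Longrightarrow> j' \<le> k t' \<Longrightarrow> f t j \<bullet> f t' j' =
      (if t = t' then (if j = j' then 1 / 2 else 0) - 1 / (2 * (real (k t) + 1)) else 0)"
    using orthogonal_regular_simplices[of "{0, 1, 2}" k] by blast
  have f0: "f 0 i \<bullet> f 0 j = (if i = j then 1 / 2 else 0) - 1 / (2 * real \<alpha>)"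
    if "i < \<alpha>" "j < \<alpha>" for i j
    using that f[of 0 0 i j] by (auto simp: k_def of_nat_diff)
  have f1: "f 1 i \<bullet> f 1 j = (if i = j then 1 / 2 else 0) - 1 / (2 * real \<beta>)"
    if "i < \<beta>" "j < \<beta>" for i j
    using that f[of 1 1 i j] by (auto simp: k_def of_nat_diff)
  have f2: "f 2 0 \<bullet> f 2 0 = 1 / 4" if "\<beta> \<ge> 1"
    using that f[of 2 2 0 0] by (auto simp: k_def)
  have f01: "f 0 i \<bullet> f 1 j = 0" "f 1 j \<bullet> f 0 i = 0" if "i < \<alpha>" "j < \<beta>" for i j
    using that f[of 0 1 i j] f[of 1 0 j i] by (auto simp: k_def)
  have f02: "f 0 i \<bullet> f 2 0 = 0" "f 2 0 \<bullet> f 0 i = 0" if "i < \<alpha>" for i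
    using that f[of 0 2 i 0] f[of 2 0 0 i] by (auto simp: k_def)
  have f12: "f 1 i \<bullet> f 2 0 = 0" "f 2 0 \<bullet> f 1 i = 0" if "i < \<beta>" for i
    using that f[of 1 2 i 0] f[of 2 1 0 i] by (auto simp: k_def)
  define h where "h = sqrt (d\<^sup>2 -
    ((real \<alpha> - 1) / (2 * real \<alpha>) * d\<^sub>1\<^sup>2 + (real \<beta> - 1) / (2 * real \<beta>) * d\<^sub>2\<^sup>2))"
  have h: "h * h = d\<^sup>2 -
    ((real \<alpha> - 1) / (2 * real \<alpha>) * d\<^sub>1\<^sup>2 + (real \<beta> - 1) / (2 * real \<beta>) * d\<^sub>2\<^sup>2)" if "\<beta> \<ge> 1"
    using ineq[OF that] by (simp add: h_def)
  \<comment> \<open>The vector \<open>f 2 0\<close> has norm \<open>1 / 2\<close>, so the centroids are at distance \<open>h\<close>.\<close>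
  define x where
    "x i = (if i < \<alpha> then d\<^sub>1 *\<^sub>R f 0 i else d\<^sub>2 *\<^sub>R f 1 (i - \<alpha>) + (2 * h) *\<^sub>R f 2 0)" for i
  have 1: "norm (x i - x j) = d\<^sub>1" if "i < \<alpha>" "j < \<alpha>" "i \<noteq> j" for i j
    using that d by (simp add: norm_diff_eq_sqrt_inner x_def f0 algebra_simps)
  have 2: "norm (x i - x j) = d\<^sub>2" if "\<not> i < \<alpha>" "\<not> j < \<alpha>" "i < \<alpha> + \<beta>" "j < \<alpha> + \<beta>" "i \<noteq> j" for i j
  proof -
    have "x i - x j = d\<^sub>2 *\<^sub>R (f 1 (i - \<alpha>) - f 1 (j - \<alpha>))"
      using that by (simp add: x_def algebra_simps)
    moreover have "norm (f 1 (i - \<alpha>) - f 1 (j - \<alpha>)) = 1"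
      using that by (simp add: norm_diff_eq_sqrt_inner f1[simplified] less_diff_conv2 eq_diff_iff)
    ultimately show ?thesis using d by simp
  qed
  have 3: "norm (x i - x j) = d" if "i < \<alpha>" "\<not> j < \<alpha>" "j < \<alpha> + \<beta>" for i j
  proof -
    have \<beta>: "\<beta> \<ge> 1" and j: "j - \<alpha> < \<beta>" using that by auto
    have "x i \<bullet> x i = (real \<alpha> - 1) / (2 * real \<alpha>) * d\<^sub>1\<^sup>2"
      using that by (simp add: x_def f0 field_simps power2_eq_square)
    moreover have "x i \<bullet> x j = 0"
      using that j by (simp add: x_def inner_add_right f01[simplified] f02)
    moreover have "x j \<bullet> x j = (real \<beta> - 1) / (2 * real \<beta>) * d\<^sub>2\<^sup>2 + h * h"
    proof -
      have "x j \<bullet> x j = d\<^sub>2 * d\<^sub>2 * (1 / 2 - 1 / (2 * real \<beta>)) + h * h"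
        using that j f2[OF \<beta>]
        by (simp add: x_def inner_add_right inner_add_left f1[simplified] f12[simplified])
      thus ?thesis using \<beta> by (simp add: field_simps power2_eq_square)
    qed
    ultimately show ?thesis
      using d h[OF \<beta>] by (simp add: norm_diff_eq_sqrt_inner)
  qed
  have "norm (x i - x j) = (if i < \<alpha> \<and> j < \<alpha> then d\<^sub>1 else if i < \<alpha> \<or> j < \<alpha> then d else d\<^sub>2)"
    if "i < \<alpha> + \<beta>" "j < \<alpha> + \<beta>" "i \<noteq> j" for i j
    using 1[of i j] 2[of i j] 3[of i j] 3[of j i] that norm_minus_commute[of "x i" "x j"] by auto
  thus ?thesis by blast
qed

section \<open>The inequality for a single large group\<close>

text \<open>
  Write \<open>u\<close> and \<open>w\<close> for the two square roots. Then \<open>1 - u\<^sup>2 = 1 / c\<close>, while \<open>1 - w\<^sup>2\<close> is the mean of \<open>1 / c\<close> and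
  \<open>1 / (c + 1)\<close>, at least \<open>5 / 6\<close> of \<open>1 / c\<close> because \<open>c \<ge> 2\<close>. Cancelling \<open>1 + u \<ge> 17 / 10\<close> and
  \<open>1 + w \<le> 2\<close> costs a further factor \<open>17 / 20\<close>, and \<open>17 / 24 = (5 / 6) (17 / 20)\<close> is just above
  \<open>1 / sqrt 2\<close>.
\<close>

lemma one_minus_sqrt_average_ge:
  fixes c :: real
  assumes "c \<ge> 2"
  shows "(1 - sqrt ((c - 1) / c))\<^sup>2 / 2
    \<le> (1 - sqrt (1 / 2 * ((c - 1) / c + c / (c + 1))))\<^sup>2"
proof -
  define u where "u = sqrt ((c - 1) / c)"
  define w where "w = sqrt (1 / 2 * ((c - 1) / c + c / (c + 1)))"
  have u2: "1 - u\<^sup>2 = 1 / c" using assms by (simp add: u_def field_simps)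
  have nonneg: "0 \<le> 1 / 2 * ((c - 1) / c + c / (c + 1))" using assms by simp
  hence "w\<^sup>2 = 1 / 2 * ((c - 1) / c + c / (c + 1))" unfolding w_def by (rule real_sqrt_pow2)
  moreover have "(c - 1) / c = 1 - 1 / c" "c / (c + 1) = 1 - 1 / (c + 1)"
    using assms by (simp_all add: field_simps)
  ultimately have w2: "1 - w\<^sup>2 = (1 / c + 1 / (c + 1)) / 2" by simp
  have mean: "5 / 6 * s \<le> (s + t) / 2" if "2 / 3 * s \<le> t" for s t :: real
    using that by (simp add: field_simps)
  have w2_ge: "1 - w\<^sup>2 \<ge> 5 / 6 * (1 - u\<^sup>2)"
    unfolding u2 w2 by (rule mean) (use assms in \<open>simp add: field_simps\<close>)
  have w0: "0 \<le> w" unfolding w_def using nonneg by (rule real_sqrt_ge_zero)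
  have "0 \<le> 1 - w\<^sup>2" unfolding w2 using assms by simp
  hence w1: "w \<le> 1" using w0 by (simp add: power_le_one_iff)
  have u1: "u < 1" using assms by (simp add: u_def)
  have u: "u \<ge> 7 / 10" unfolding u_def
    by (rule real_le_rsqrt) (use assms in \<open>simp add: field_simps power2_eq_square\<close>)
  have "17 / 10 * (1 - u) \<le> (1 + u) * (1 - u)" using u u1 by (intro mult_right_mono) auto
  also have "(1 + u) * (1 - u) = 1 - u\<^sup>2" by (simp add: power2_eq_square algebra_simps)
  also have "\<dots> \<le> 6 / 5 * (1 - w\<^sup>2)" using w2_ge by (simp add: field_simps)
  also have "1 - w\<^sup>2 = (1 + w) * (1 - w)" by (simp add: power2_eq_square algebra_simps)
  also have "6 / 5 * ((1 + w) * (1 - w)) \<le> 6 / 5 * (2 * (1 - w))"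
    using w0 w1 by (intro mult_left_mono mult_right_mono) auto
  finally have "17 / 24 * (1 - u) \<le> 1 - w" by simp
  hence "(17 / 24 * (1 - u))\<^sup>2 \<le> (1 - w)\<^sup>2" using u1 by (intro power_mono) auto
  moreover have "(17 / 24 * (1 - u))\<^sup>2 = 289 / 576 * (1 - u)\<^sup>2"
    unfolding power_mult_distrib power_divide by simp
  moreover have "(1 - u)\<^sup>2 \<ge> 0" by simp
  ultimately show ?thesis unfolding u_def w_def by linarith
qed

section \<open>The equilateral set\<close>

lemma equilateral_image:
  assumes "\<And>p q. p \<in> J \<Longrightarrow> q \<in> J \<Longrightarrow> p \<noteq> q \<Longrightarrow> norm (F p - F q) = 1"
  shows "equilateral (F ` J)" "card (F ` J) = card J"
proof -
  show "equilateral (F ` J)"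
    unfolding equilateral_def by (intro exI[of _ 1]) (use assms in auto)
  have "inj_on F J"
    by (rule inj_onI, rule ccontr) (use assms in fastforce)
  thus "card (F ` J) = card J" by (rule card_image)
qed

theorem theorem4:
  fixes a b \<alpha> \<beta> :: nat and c :: int
  assumes "CARD('m::finite) = a" and "CARD('n::finite) = b"
    and "a \<ge> 2" and "b > a"
    and "c = \<lfloor>1 + real b / real (a + 1)\<rfloor>"
    and "\<beta> = b mod (a + 1)"
    and "\<alpha> = a + 1 - \<beta>"
    and "\<beta> \<in> {0, 1, a} \<or>
      (real \<alpha> - 1) / (2 * real \<alpha>) * (1 - sqrt ((real_of_int c - 1) / real_of_int c))\<^sup>2
      + (real \<beta> - 1) / (2 * real \<beta>) * (1 - sqrt (real_of_int c / (real_of_int c + 1)))\<^sup>2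
      \<le> (1 - sqrt (1 / 2 * ((real_of_int c - 1) / real_of_int c
                            + real_of_int c / (real_of_int c + 1))))\<^sup>2"
  shows "equilateral_size TYPE((real ^ 'm) \<oplus>\<^sub>1 (real ^ 'n)) \<ge> a + b + 1"
proof -
  \<comment> \<open>\<open>N\<close> is \<open>c - 1\<close>, the dimension of the simplex of a small group, and \<open>C\<close> is \<open>c\<close> as a real number.\<close>
  define N where "N = b div (a + 1)"
  define C where "C = real N + 1"
  have c: "c = int N + 1"
    unfolding assms(5) N_def floor_divide_of_nat_eq[symmetric, where 'a = real] by linarith
  have cC: "real_of_int c = C" by (simp add: c C_def)
  have N1: "N \<ge> 1" using assms(4) by (simp add: N_def div_greater_zero_iff Suc_le_eq)
  hence C2: "C \<ge> 2" by (simp add: C_def)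
  have b: "b = N * (a + 1) + \<beta>" unfolding N_def assms(6) by (rule div_mult_mod_eq[symmetric])
  have \<beta>: "\<beta> \<le> a" unfolding assms(6) using mod_less_divisor[of "a + 1" b] by simp
  have \<alpha>: "\<alpha> \<ge> 1" "\<alpha> + \<beta> = a + 1" using assms(7) \<beta> by auto
  define d\<^sub>1 where "d\<^sub>1 = 1 - sqrt ((C - 1) / C)"
  define d\<^sub>2 where "d\<^sub>2 = 1 - sqrt (C / (C + 1))"
  define d where "d = 1 - sqrt (1 / 2 * ((C - 1) / C + C / (C + 1)))"
  have uv: "(C - 1) / C \<le> C / (C + 1)" "C / (C + 1) \<le> 1" using C2 by (auto simp: field_simps)
  have d2: "0 \<le> d\<^sub>2" unfolding d\<^sub>2_def using uv by simp
  have mean: "1 / 2 * (s + t) \<le> t" if "s \<le> t" for s t :: real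
    using that by (simp add: field_simps)
  have d2d: "d\<^sub>2 \<le> d"
    unfolding d_def d\<^sub>2_def by (intro diff_left_mono real_sqrt_le_mono mean uv(1))
  have d1: "0 \<le> d\<^sub>1" unfolding d\<^sub>1_def using uv by simp
  have half: "(real n - 1) / (2 * real n) * t\<^sup>2 \<le> t\<^sup>2 / 2" if "n \<ge> 1" for n t
  proof -
    have "(real n - 1) / (2 * real n) \<le> 1 / 2" using that by (simp add: field_simps)
    from mult_right_mono[OF this, of "t\<^sup>2"] show ?thesis by simp
  qed
  have ineq: "(real \<alpha> - 1) / (2 * real \<alpha>) * d\<^sub>1\<^sup>2 + (real \<beta> - 1) / (2 * real \<beta>) * d\<^sub>2\<^sup>2 \<le> d\<^sup>2"
    if "\<beta> \<ge> 1"
  proof -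
    consider "\<beta> = 1" | "\<beta> = a" | "\<beta> \<noteq> 1" "\<beta> \<noteq> a" by blast
    thus ?thesis
    proof cases
      case 1
      hence "(real \<beta> - 1) / (2 * real \<beta>) * d\<^sub>2\<^sup>2 = 0" by simp
      moreover have "d\<^sub>1\<^sup>2 / 2 \<le> d\<^sup>2"
        unfolding d\<^sub>1_def d_def using C2 by (rule one_minus_sqrt_average_ge)
      ultimately show ?thesis using half[OF \<alpha>(1), of d\<^sub>1] by linarith
    next
      case 2
      hence "\<alpha> = 1" using \<alpha>(2) by simp
      hence "(real \<alpha> - 1) / (2 * real \<alpha>) * d\<^sub>1\<^sup>2 = 0" by simp
      moreover have "d\<^sub>2\<^sup>2 \<le> d\<^sup>2" using d2d d2 by (rule power_mono)
      ultimately show ?thesis using half[OF that, of d\<^sub>2] zero_le_power2[of d\<^sub>2] by linarith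
    next
      case 3
      hence "\<beta> \<notin> {0, 1, a}" using that by simp
      thus ?thesis using assms(8) unfolding cC d\<^sub>1_def d\<^sub>2_def d_def by blast
    qed
  qed
  obtain x :: "nat \<Rightarrow> real ^ 'm" where x: "\<And>i j. i < a + 1 \<Longrightarrow> j < a + 1 \<Longrightarrow> i \<noteq> j \<Longrightarrow>
    norm (x i - x j) = (if i < \<alpha> \<and> j < \<alpha> then d\<^sub>1 else if i < \<alpha> \<or> j < \<alpha> then d else d\<^sub>2)"
  proof -
    have "\<alpha> + \<beta> \<le> DIM(real ^ 'm) + 1" using \<alpha>(2) assms(1) by simp
    moreover have "0 \<le> d" using d2 d2d by (rule order_trans)
    ultimately show ?thesis
      using two_regular_simplices_at_distance[where 'a = "real ^ 'm", OF \<alpha>(1) _ d1 d2 _ ineq] that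
      unfolding \<alpha>(2) by blast
  qed
  \<comment> \<open>Group \<open>i\<close> has \<open>k i + 1\<close> points.\<close>
  define k where "k i = (if i < \<alpha> then N else N + 1)" for i
  have sum_k: "(\<Sum>i<a + 1. k i) = b"
  proof -
    have "(\<Sum>i<a + 1. k i) = (\<Sum>i<\<alpha>. k i) + (\<Sum>i=\<alpha>..<\<alpha> + \<beta>. k i)"
      unfolding \<alpha>(2)[symmetric] lessThan_atLeast0 by (simp add: sum.atLeastLessThan_concat)
    also have "\<dots> = \<alpha> * N + \<beta> * (N + 1)" by (simp add: k_def)
    also have "\<dots> = (\<alpha> + \<beta>) * N + \<beta>" by (simp add: algebra_simps)
    finally show ?thesis using b unfolding \<alpha>(2) by (simp add: mult.commute)
  qed
  obtain y :: "nat \<Rightarrow> nat \<Rightarrow> real ^ 'n" where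
    y: "\<And>i i' j j'. i < a + 1 \<Longrightarrow> i' < a + 1 \<Longrightarrow> j \<le> k i \<Longrightarrow> j' \<le> k i' \<Longrightarrow> y i j \<bullet> y i' j' =
      (if i = i' then (if j = j' then 1 / 2 else 0) - 1 / (2 * (real (k i) + 1)) else 0)"
  proof -
    have "(\<Sum>i<a + 1. k i) \<le> DIM(real ^ 'n)" unfolding sum_k using assms(2) by simp
    from orthogonal_regular_simplices[OF finite_lessThan this] show ?thesis
      using that unfolding Ball_def lessThan_iff by blast
  qed
  define J where "J = (SIGMA i:{..<a + 1}. {..k i})"
  define F where "F = (\<lambda>(i, j). L1_Pair (x i) (y i j))"
  have F: "norm (F p - F q) = 1" if pq: "p \<in> J" "q \<in> J" "p \<noteq> q" for p q
  proof -
    obtain i j i' j' where p: "p = (i, j)" and q: "q = (i', j')" by (metis surj_pair)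
    have ij: "i < a + 1" "i' < a + 1" "j \<le> k i" "j' \<le> k i'" using pq(1,2) by (auto simp: J_def p q)
    have n: "norm (F p - F q) = norm (x i - x i') + norm (y i j - y i' j')"
      by (simp add: F_def p q norm_l1_sum_def minus_l1_sum_def)
    show ?thesis
    proof (cases "i = i'")
      case True
      hence "j \<noteq> j'" using pq(3) p q by simp
      thus ?thesis using True ij by (simp add: n norm_diff_eq_sqrt_inner y)
    next
      case False
      have "norm (y i j - y i' j')
          = sqrt (1 - 1 / (2 * (real (k i) + 1)) - 1 / (2 * (real (k i') + 1)))"
        using False ij by (simp add: norm_diff_eq_sqrt_inner y)
      moreover have "1 - 1 / (2 * C) - 1 / (2 * C) = (C - 1) / C"
        "1 - 1 / (2 * (C + 1)) - 1 / (2 * (C + 1)) = C / (C + 1)"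
        "1 - 1 / (2 * C) - 1 / (2 * (C + 1)) = 1 / 2 * ((C - 1) / C + C / (C + 1))"
        "1 - 1 / (2 * (C + 1)) - 1 / (2 * C) = 1 / 2 * ((C - 1) / C + C / (C + 1))"
      proof -
        have C: "(C - 1) / C = 1 - 1 / C" "C / (C + 1) = 1 - 1 / (C + 1)"
          using C2 by (simp_all add: field_simps)
        have half: "1 / (2 * t) = (1 / t) / 2" for t :: real by simp
        have mean: "1 - s / 2 - t / 2 = 1 / 2 * ((1 - s) + (1 - t))" for s t :: real
          by (simp add: field_simps)
        show "1 - 1 / (2 * C) - 1 / (2 * C) = (C - 1) / C"
          "1 - 1 / (2 * (C + 1)) - 1 / (2 * (C + 1)) = C / (C + 1)"
          "1 - 1 / (2 * C) - 1 / (2 * (C + 1)) = 1 / 2 * ((C - 1) / C + C / (C + 1))"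
          "1 - 1 / (2 * (C + 1)) - 1 / (2 * C) = 1 / 2 * ((C - 1) / C + C / (C + 1))"
          unfolding half mean C by simp_all
      qed
      moreover have "real (k t) + 1 = (if t < \<alpha> then C else C + 1)" for t
        by (simp add: k_def C_def)
      ultimately show ?thesis
        unfolding n x[OF ij(1,2) False] d\<^sub>1_def d\<^sub>2_def d_def by (cases "i < \<alpha>"; cases "i' < \<alpha>") simp_all
    qed
  qed
  have "card J = (\<Sum>i<a + 1. k i) + (a + 1)"
    unfolding J_def by (simp add: sum.distrib[of k "\<lambda>_. 1", simplified] del: sum.lessThan_Suc)
  hence "card (F ` J) = a + b + 1"
    using equilateral_image(2)[of J F] F sum_k by (auto simp del: sum.lessThan_Suc)
  moreover have "equilateral (F ` J)" using equilateral_image(1)[of J F] F by blast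
  ultimately show ?thesis
    using equilateral_size_upper[of "F ` J" "TYPE((real ^ 'm) \<oplus>\<^sub>1 (real ^ 'n))"] by simp
qed

end
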